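(* Let $p,q,r>0$ with $p+q+r=1$ and $p<q$, and let $\lambda=p/q$. Let $Q$ be the transition matrix on $\mathbb N\cup\{0\}$, $\mathbb N=\{1,2,\dots\}$, of the random walk with delay absorbed at $0$: $Q(0,0)=1$, and for $x\ge1$, $Q(x,x-1)=q$, $Q(x,x)=r$, $Q(x,x+1)=p$, $Q(x,y)=0$ if $|x-y|>1$. Let $$\nu_{\min}(x)=\bigl(1-\sqrt\lambda\bigr)^2\,x\,\bigl(\sqrt\lambda\bigr)^{x-1},\qquad x\ge1.$$ If $pq\le r^2$, then: (i) $\delta_1T_n\preccurlyeq\delta_1T_{n+1}$ for all $n\ge0$. (ii) For any probability measure $\nu$ on $\mathbb N$ and all $n\ge0$, $\delta_1T_n\preccurlyeq\nu T_n$. (iii) If $\nu$ is a quasi-stationary distribution, then $\delta_1T_n\preccurlyeq\nu$ for all $n\ge0$. (iv) $\lim_n\delta_1T_n=\nu_{\min}$, which is a quasi-stationary distribution and satisfies $\nu_{\min}\preccurlyeq\nu$ for any other quasi-stationary distribution $\nu$. Furthermore, for any $x\in\mathbb N$, the Yaglom limit of $\delta_x$ converges to $\nu_{\min}$, i.e. $\lim_n\delta_xT_n=\nu_{\min}$.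
   Context: $\delta_x$ is the probability measure on $\mathbb N$ concentrated at $x$, and $\preccurlyeq$ denotes the stochastic order of probability measures on $\mathbb N$ induced by the usual order. For a probability measure $\nu$ on $\mathbb N$ and $n\ge0$, $\nu T_n(y):=\frac{\nu Q^n(y)}{1-\nu Q^n(0)}$, $y\in\mathbb N$: the law at time $n$ of the chain started from $\nu$, conditioned on not being absorbed at $0$ by time $n$. A probability measure $\nu$ on $\mathbb N$ is a quasi-stationary distribution if $\nu=\nu T_1$. The Yaglom limit of $\nu$ is $\lim_n\nu T_n$, if this limit exists (pointwise) and is a probability measure. *)

theory Defs
  imports "HOL-Probability.Probability_Mass_Function"
begin

text \<open>
  The state space is \<open>nat\<close>, with \<open>0\<close> absorbing; a probability measure on
  \<open>{1, 2, \<dots>}\<close> is a \<^typ>\<open>nat pmf\<close> without mass at \<open>0\<close>.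
\<close>

definition prob_on_pos :: "nat pmf \<Rightarrow> bool" where
  "prob_on_pos \<nu> \<longleftrightarrow> pmf \<nu> 0 = 0"

definition stoch_le :: "nat pmf \<Rightarrow> nat pmf \<Rightarrow> bool" (infix "\<preceq>\<^sub>s\<^sub>t" 50) where
  "\<mu> \<preceq>\<^sub>s\<^sub>t \<nu> \<longleftrightarrow> (\<forall>f :: nat \<Rightarrow> real. mono f \<longrightarrow> bounded (range f) \<longrightarrow>
     measure_pmf.expectation \<mu> f \<le> measure_pmf.expectation \<nu> f)"

lemma stoch_le_iff_tails:
  "\<mu> \<preceq>\<^sub>s\<^sub>t \<nu> \<longleftrightarrow> (\<forall>x. measure_pmf.prob \<mu> {x..} \<le> measure_pmf.prob \<nu> {x..})"
proof
  assume L: "\<mu> \<preceq>\<^sub>s\<^sub>t \<nu>"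
  show "\<forall>x. measure_pmf.prob \<mu> {x..} \<le> measure_pmf.prob \<nu> {x..}"
  proof
    fix x
    let ?f = "indicator {x..} :: nat \<Rightarrow> real"
    have "mono ?f"
      by (auto intro!: monoI simp: indicator_def)
    moreover have "bounded (range ?f)"
      by (rule boundedI[of _ 1]) (auto simp: indicator_def)
    ultimately have "measure_pmf.expectation \<mu> ?f \<le> measure_pmf.expectation \<nu> ?f"
      using L unfolding stoch_le_def by blast
    then show "measure_pmf.prob \<mu> {x..} \<le> measure_pmf.prob \<nu> {x..}"
      by simp
  qed
next
  assume R: "\<forall>x. measure_pmf.prob \<mu> {x..} \<le> measure_pmf.prob \<nu> {x..}"
  show "\<mu> \<preceq>\<^sub>s\<^sub>t \<nu>"
    unfolding stoch_le_def
  proof (intro allI impI)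
    fix f :: "nat \<Rightarrow> real"
    assume f: "mono f" "bounded (range f)"
    from f(2) obtain B where B: "\<And>x. \<bar>f x\<bar> \<le> B"
      by (auto simp: bounded_iff)
    have trunc: "f (min k n) = f 0 + (\<Sum>i<n. (f (Suc i) - f i) * indicator {Suc i..} k)" for k n
    proof (induction n)
      case (Suc n)
      show ?case
      proof (cases "Suc n \<le> k")
        case True
        then show ?thesis using Suc by simp
      next
        case False
        then have "min k (Suc n) = min k n" by simp
        then show ?thesis using Suc False by simp
      qed
    qed simp
    have ex: "measure_pmf.expectation M (\<lambda>k. f (min k n)) =
        f 0 + (\<Sum>i<n. (f (Suc i) - f i) * measure_pmf.prob M {Suc i..})" for M :: "nat pmf" and n
    proof -
      have int: "integrable M (\<lambda>k. (f (Suc i) - f i) * indicator {Suc i..} k)" for i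
        by (rule integrable_mult_right) (simp add: measure_pmf.emeasure_eq_measure)
      then have "integrable M (\<lambda>k. \<Sum>i<n. (f (Suc i) - f i) * indicator {Suc i..} k)"
        by (intro Bochner_Integration.integrable_sum)
      then have "measure_pmf.expectation M (\<lambda>k. f (min k n)) = f 0 +
          measure_pmf.expectation M (\<lambda>k. \<Sum>i<n. (f (Suc i) - f i) * indicator {Suc i..} k)"
        unfolding trunc by (subst Bochner_Integration.integral_add) auto
      also have "measure_pmf.expectation M (\<lambda>k. \<Sum>i<n. (f (Suc i) - f i) * indicator {Suc i..} k) =
          (\<Sum>i<n. measure_pmf.expectation M (\<lambda>k. (f (Suc i) - f i) * indicator {Suc i..} k))"
        by (rule Bochner_Integration.integral_sum) (rule int)
      finally show ?thesis by simp
    qed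
    have lim: "(\<lambda>n. measure_pmf.expectation M (\<lambda>k. f (min k n)))
        \<longlonglongrightarrow> measure_pmf.expectation M f" for M :: "nat pmf"
    proof (rule integral_dominated_convergence[where w = "\<lambda>_. B"])
      show "AE x in M. (\<lambda>n. f (min x n)) \<longlonglongrightarrow> f x"
      proof (rule AE_I2)
        fix x
        have "eventually (\<lambda>n. f (min x n) = f x) sequentially"
          using eventually_ge_at_top[of x] by eventually_elim simp
        then show "(\<lambda>n. f (min x n)) \<longlonglongrightarrow> f x"
          by (rule tendsto_eventually)
      qed
    qed (use B in auto)
    show "measure_pmf.expectation \<mu> f \<le> measure_pmf.expectation \<nu> f"
    proof (rule LIMSEQ_le[OF lim lim])
      show "\<exists>N. \<forall>n\<ge>N. measure_pmf.expectation \<mu> (\<lambda>k. f (min k n))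
          \<le> measure_pmf.expectation \<nu> (\<lambda>k. f (min k n))"
        unfolding ex using R f(1)
        by (auto intro!: exI[of _ 0] sum_mono mult_left_mono simp: mono_def)
    qed
  qed
qed

definition Q_matrix :: "real \<Rightarrow> real \<Rightarrow> real \<Rightarrow> nat \<Rightarrow> nat \<Rightarrow> real" where
  "Q_matrix p q r x y =
     (if x = 0 then (if y = 0 then 1 else 0)
      else if y = x - 1 then q
      else if y = x then r
      else if y = x + 1 then p
      else 0)"

text \<open>The rows of the transition matrix as probability measures.\<close>

definition Q_kernel :: "real \<Rightarrow> real \<Rightarrow> real \<Rightarrow> nat \<Rightarrow> nat pmf" where
  "Q_kernel p q r x = embed_pmf (Q_matrix p q r x)"

lemma pmf_Q_kernel:
  assumes "0 < p" "0 < q" "0 < r" "p + q + r = 1"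
  shows "pmf (Q_kernel p q r x) y = Q_matrix p q r x y"
  unfolding Q_kernel_def
proof (rule pmf_embed_pmf)
  show nn: "0 \<le> Q_matrix p q r x y" for y
    using assms by (simp add: Q_matrix_def)
  have "(\<integral>\<^sup>+ y. ennreal (Q_matrix p q r x y) \<partial>count_space UNIV) =
      (\<Sum>y\<in>{x - 1, x, x + 1}. ennreal (Q_matrix p q r x y))"
    by (rule nn_integral_count_space'[of "{x - 1, x, x + 1}"]) (auto simp: Q_matrix_def)
  also have "\<dots> = ennreal (\<Sum>y\<in>{x - 1, x, x + 1}. Q_matrix p q r x y)"
    using nn by (simp add: sum_ennreal)
  also have "(\<Sum>y\<in>{x - 1, x, x + 1}. Q_matrix p q r x y) = 1"
  proof (cases x)
    case 0
    then show ?thesis by (simp add: Q_matrix_def)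
  next
    case (Suc m)
    then show ?thesis using assms by (simp add: Q_matrix_def)
  qed
  finally show "(\<integral>\<^sup>+ y. ennreal (Q_matrix p q r x y) \<partial>count_space UNIV) = 1"
    by simp
qed

text \<open>\<open>evolve K n \<nu>\<close> is \<open>\<nu> K\<^sup>n\<close>, the law at time \<open>n\<close> of the chain started from \<open>\<nu>\<close>.\<close>

definition evolve :: "(nat \<Rightarrow> nat pmf) \<Rightarrow> nat \<Rightarrow> nat pmf \<Rightarrow> nat pmf" where
  "evolve K n \<nu> = ((\<lambda>\<mu>. bind_pmf \<mu> K) ^^ n) \<nu>"

text \<open>
  \<open>cond_evolve K n \<nu>\<close> is \<open>\<nu> T\<^sub>n\<close>. Since \<open>cond_pmf\<close> is unspecified when the conditioning
  event has probability \<open>0\<close>, the two lemmas below show that the event has positive probability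
  and that the defining quotient formula holds for the walk.
\<close>

definition cond_evolve :: "(nat \<Rightarrow> nat pmf) \<Rightarrow> nat \<Rightarrow> nat pmf \<Rightarrow> nat pmf" where
  "cond_evolve K n \<nu> = cond_pmf (evolve K n \<nu>) {1..}"

lemma evolve_not_absorbed:
  assumes "0 < p" "0 < q" "0 < r" "p + q + r = 1" and "prob_on_pos \<nu>"
  shows "set_pmf (evolve (Q_kernel p q r) n \<nu>) \<inter> {1..} \<noteq> {}"
proof -
  obtain x where x: "x \<in> set_pmf \<nu>"
    using set_pmf_not_empty[of \<nu>] by blast
  with assms(5) have "x \<noteq> 0"
    unfolding prob_on_pos_def set_pmf_eq by (metis mem_Collect_eq)
  then have loop: "x \<in> set_pmf (Q_kernel p q r x)"
    using assms by (auto simp: set_pmf_eq pmf_Q_kernel Q_matrix_def)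
  have "x \<in> set_pmf (evolve (Q_kernel p q r) n \<nu>)"
    proof (induction n)
    case 0
    show ?case using x by (simp add: evolve_def)
  next
    case (Suc n)
    with loop show ?case by (auto simp: evolve_def)
  qed
  with \<open>x \<noteq> 0\<close> show ?thesis by auto
qed

lemma pmf_cond_evolve:
  assumes "0 < p" "0 < q" "0 < r" "p + q + r = 1" and "prob_on_pos \<nu>"
  shows "pmf (cond_evolve (Q_kernel p q r) n \<nu>) y =
    (if y = 0 then 0
     else pmf (evolve (Q_kernel p q r) n \<nu>) y / (1 - pmf (evolve (Q_kernel p q r) n \<nu>) 0))"
proof -
  let ?M = "evolve (Q_kernel p q r) n \<nu>"
  have "measure_pmf.prob ?M {1..} = measure_pmf.prob ?M (UNIV - {0})"
    by (rule arg_cong[where f = "measure_pmf.prob ?M"]) auto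
  also have "\<dots> = 1 - pmf ?M 0"
    using measure_pmf.prob_compl[of "{0}" ?M] by (simp add: measure_pmf_single)
  finally show ?thesis
    unfolding cond_evolve_def using pmf_cond[OF evolve_not_absorbed[OF assms]] by auto
qed

definition quasi_stationary :: "(nat \<Rightarrow> nat pmf) \<Rightarrow> nat pmf \<Rightarrow> bool" where
  "quasi_stationary K \<nu> \<longleftrightarrow> prob_on_pos \<nu> \<and> \<nu> = cond_evolve K 1 \<nu>"

definition pmf_tendsto :: "(nat \<Rightarrow> nat pmf) \<Rightarrow> nat pmf \<Rightarrow> bool" where
  "pmf_tendsto M \<mu> \<longleftrightarrow> (\<forall>y. (\<lambda>n. pmf (M n) y) \<longlonglongrightarrow> pmf \<mu> y)"

definition yaglom_limit :: "(nat \<Rightarrow> nat pmf) \<Rightarrow> nat pmf \<Rightarrow> nat pmf \<Rightarrow> bool" where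
  "yaglom_limit K \<nu> \<mu> \<longleftrightarrow> prob_on_pos \<mu> \<and> pmf_tendsto (\<lambda>n. cond_evolve K n \<nu>) \<mu>"

text \<open>The factor \<open>x\<close> makes the mass at \<open>0\<close> vanish.\<close>

definition nu_min :: "real \<Rightarrow> real \<Rightarrow> nat pmf" where
  "nu_min p q = (let lam = p / q in
     embed_pmf (\<lambda>x. (1 - sqrt lam)\<^sup>2 * real x * sqrt lam ^ (x - 1)))"

lemma pmf_nu_min:
  assumes "0 < p" "p < q"
  shows "pmf (nu_min p q) x = (1 - sqrt (p / q))\<^sup>2 * real x * sqrt (p / q) ^ (x - 1)"
  unfolding nu_min_def Let_def
proof (rule pmf_embed_pmf)
  let ?s = "sqrt (p / q)"
  let ?f = "\<lambda>x. (1 - ?s)\<^sup>2 * real x * ?s ^ (x - 1)"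
  have s: "0 \<le> ?s" "?s < 1" using assms by auto
  show nn: "0 \<le> ?f x" for x using s by simp
  have "(\<lambda>n. real (Suc n) * ?s ^ n) sums (1 / (1 - ?s)\<^sup>2)"
    using geometric_deriv_sums[of ?s] s by simp
  then have "(\<lambda>n. (1 - ?s)\<^sup>2 * (real (Suc n) * ?s ^ n)) sums ((1 - ?s)\<^sup>2 * (1 / (1 - ?s)\<^sup>2))"
    by (rule sums_mult)
  moreover have "(1 - ?s)\<^sup>2 * (1 / (1 - ?s)\<^sup>2) = 1"
    using assms by simp
  ultimately have "(\<lambda>n. ?f (Suc n)) sums 1"
    by (simp only: mult.assoc diff_Suc_1)
  then have "?f sums 1"
    using sums_Suc[of ?f 1] by simp
  then show "(\<integral>\<^sup>+ x. ennreal (?f x) \<partial>count_space UNIV) = 1"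
    unfolding nn_integral_count_space_nat by (subst suminf_ennreal_eq[OF nn]) auto
qed

end

theory Submission
  imports Defs
begin

text \<open>
  On the positive states the kernel is totally positive of order 2 (its only nontrivial minor is
  \<open>r\<^sup>2 - p q\<close>), so it preserves the likelihood ratio order, which is insensitive to normalisation
  and implies the stochastic order. As \<open>\<delta>\<^sub>1\<close> is the least measure for the likelihood ratio order,
  (i), (ii) and (iii) follow. Monotonicity makes \<open>\<delta>\<^sub>1 T\<^sub>n\<close> converge pointwise to a nonnegative
  solution \<open>m\<close> of the eigenvalue recursion with \<open>m 1 \<ge> \<nu>\<^sub>m\<^sub>i\<^sub>n 1\<close>, that is, with eigenvalue at most
  \<open>r + 2 sqrt (p q)\<close>. Solutions with a smaller eigenvalue oscillate, so \<open>m = \<nu>\<^sub>m\<^sub>i\<^sub>n\<close>. For other initial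
  states, the survival probabilities from \<open>1\<close> decay at a convergent ratio, and the backward equation
  yields the limits of \<open>Q\<^sup>n(x, y)\<close> over the survival probability from \<open>1\<close> by induction on \<open>x\<close>.
\<close>

section \<open>Likelihood ratio order\<close>

text \<open>Cross-multiplied form of "\<open>g / f\<close> is nondecreasing", so zeros need no care.
  State \<open>0\<close> is left out because the laws to be compared may carry absorbed mass
  there.\<close>

definition lr_le :: "(nat \<Rightarrow> real) \<Rightarrow> (nat \<Rightarrow> real) \<Rightarrow> bool" where
  "lr_le f g \<longleftrightarrow> (\<forall>x y. 1 \<le> x \<longrightarrow> x \<le> y \<longrightarrow> f y * g x \<le> f x * g y)"

lemma lr_leD: "lr_le f g \<Longrightarrow> 1 \<le> x \<Longrightarrow> x \<le> y \<Longrightarrow> f y * g x \<le> f x * g y"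
  by (simp add: lr_le_def)

lemma lr_le_scale:
  assumes "lr_le f g" "0 \<le> a" "0 \<le> b"
    and "\<And>x. 1 \<le> x \<Longrightarrow> f' x = a * f x" "\<And>x. 1 \<le> x \<Longrightarrow> g' x = b * g x"
  shows "lr_le f' g'"
  unfolding lr_le_def
proof (intro allI impI)
  fix x y :: nat
  assume xy: "1 \<le> x" "x \<le> y"
  have "(a * b) * (f y * g x) \<le> (a * b) * (f x * g y)"
    using lr_leD[OF assms(1) xy] assms(2,3) by (intro mult_left_mono) auto
  then show "f' y * g' x \<le> f' x * g' y"
    using xy assms(4,5) by (simp add: mult_ac)
qed

lemma prob_atLeast_eq: "measure_pmf.prob M {x..} = 1 - (\<Sum>i<x. pmf M i)" for x :: nat
proof -
  have "measure_pmf.prob M {x..} = measure_pmf.prob M (UNIV - {..<x})"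
    by (rule arg_cong[where f = "measure_pmf.prob M"]) auto
  also have "\<dots> = 1 - (\<Sum>i<x. pmf M i)"
    using measure_pmf.prob_compl[of "{..<x}" M] by (simp add: measure_measure_pmf_finite)
  finally show ?thesis .
qed

text \<open>Summing the cross inequalities over \<open>i < x\<close> and \<open>j \<ge> x\<close>
  gives \<open>a * (1 - b) \<le> (1 - a) * b\<close> for the two tails \<open>a\<close> and
  \<open>b\<close>, which is \<open>a \<le> b\<close>.\<close>

lemma lr_le_imp_stoch_le:
  assumes "prob_on_pos \<mu>" "prob_on_pos \<nu>" "lr_le (pmf \<mu>) (pmf \<nu>)"
  shows "\<mu> \<preceq>\<^sub>s\<^sub>t \<nu>"
  unfolding stoch_le_iff_tails
proof
  fix x :: nat
  have zero: "pmf \<mu> 0 = 0" "pmf \<nu> 0 = 0"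
    using assms(1,2) by (simp_all add: prob_on_pos_def)
  let ?a = "measure_pmf.prob \<mu> {x..}" and ?b = "measure_pmf.prob \<nu> {x..}"
  have lim: "(\<lambda>N. \<Sum>j\<in>{x..<N}. pmf M j) \<longlonglongrightarrow> measure_pmf.prob M {x..}" for M :: "nat pmf"
  proof -
    have "(\<lambda>N. measure_pmf.prob M {x..<N}) \<longlonglongrightarrow> measure_pmf.prob M (\<Union>N. {x..<N})"
      by (rule measure_pmf.finite_Lim_measure_incseq) (auto simp: incseq_def)
    moreover have "(\<Union>N. {x..<N}) = {x..}" by auto
    ultimately show ?thesis by (simp add: measure_measure_pmf_finite)
  qed
  have "?a * pmf \<nu> i \<le> pmf \<mu> i * ?b" if "i < x" for i
  proof (rule LIMSEQ_le)
    show "(\<lambda>N. (\<Sum>j\<in>{x..<N}. pmf \<mu> j) * pmf \<nu> i) \<longlonglongrightarrow> ?a * pmf \<nu> i"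
      by (intro tendsto_intros lim)
    show "(\<lambda>N. pmf \<mu> i * (\<Sum>j\<in>{x..<N}. pmf \<nu> j)) \<longlonglongrightarrow> pmf \<mu> i * ?b"
      by (intro tendsto_intros lim)
    have "pmf \<mu> j * pmf \<nu> i \<le> pmf \<mu> i * pmf \<nu> j" if "x \<le> j" for j
      using lr_leD[OF assms(3), of i j] that \<open>i < x\<close> zero by (cases "i = 0") auto
    then show "\<exists>N. \<forall>n\<ge>N. (\<Sum>j\<in>{x..<n}. pmf \<mu> j) * pmf \<nu> i \<le> pmf \<mu> i * (\<Sum>j\<in>{x..<n}. pmf \<nu> j)"
      by (auto simp: sum_distrib_left sum_distrib_right intro!: sum_mono)
  qed
  then have "(\<Sum>i<x. ?a * pmf \<nu> i) \<le> (\<Sum>i<x. pmf \<mu> i * ?b)"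
    by (intro sum_mono) auto
  then have "?a * (\<Sum>i<x. pmf \<nu> i) \<le> (\<Sum>i<x. pmf \<mu> i) * ?b"
    by (simp add: sum_distrib_left sum_distrib_right)
  then have "?a * (1 - ?b) \<le> (1 - ?a) * ?b"
    by (simp add: prob_atLeast_eq)
  then show "?a \<le> ?b"
    by (simp add: algebra_simps)
qed

section \<open>Oscillation below the critical eigenvalue\<close>

text \<open>If \<open>k < 1\<close>, the sequence is concave. Being nonnegative it can never
  decrease, so it stays at or above \<open>w 1\<close>; then its increments drop by at least a fixed
  amount at each step and turn negative.\<close>

lemma nonneg_recursion_ge_1:
  fixes w :: "nat \<Rightarrow> real"
  assumes "w 0 = 0" "0 < w 1" "\<And>n. 0 \<le> w n"
    and rec: "\<And>n. w (Suc (Suc n)) = 2 * k * w (Suc n) - w n"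
  shows "1 \<le> k"
proof (rule ccontr)
  assume "\<not> 1 \<le> k"
  define e where "e = 2 * (1 - k)"
  have e: "0 < e" using \<open>\<not> 1 \<le> k\<close> by (simp add: e_def)
  define d where "d n = w (Suc n) - w n" for n
  have d_Suc: "d (Suc n) = d n - e * w (Suc n)" for n
    by (simp add: d_def e_def rec algebra_simps)
  have "d (Suc n) \<le> d n" for n
    using d_Suc[of n] e assms(3)[of "Suc n"] by simp
  then have anti: "antimono d"
    by (simp add: decseq_Suc_iff)
  \<comment> \<open>A negative increment bounds all later ones, so \<open>w\<close> would fall
    linearly below \<open>0\<close>.\<close>
  have nonneg: "0 \<le> d n" for n
  proof (rule ccontr)
    assume neg: "\<not> 0 \<le> d n"
    have le: "w (n + m) \<le> w n + real m * d n" for m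
    proof (induction m)
      case (Suc m)
      have "d (n + m) \<le> d n" using anti by (simp add: antimono_def)
      then show ?case using Suc by (simp add: d_def algebra_simps)
    qed simp
    obtain m where "w n < real m * (- d n)"
      using reals_Archimedean3[of "- d n"] neg by auto
    with le[of m] assms(3)[of "n + m"] show False by simp
  qed
  have w_ge: "w 1 \<le> w (Suc n)" for n
  proof (induction n)
    case (Suc n)
    then show ?case using nonneg[of "Suc n"] by (simp add: d_def)
  qed simp
  have le: "d n \<le> d 0 - real n * (e * w 1)" for n
  proof (induction n)
    case (Suc n)
    have "e * w 1 \<le> e * w (Suc n)" using w_ge e by (intro mult_left_mono) auto
    then show ?case using Suc d_Suc[of n] by (simp add: algebra_simps)
  qed simp
  obtain n where "d 0 < real n * (e * w 1)"
    using reals_Archimedean3[of "e * w 1"] e assms(2) by auto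
  with le[of n] nonneg[of n] show False by simp
qed

section \<open>The walk\<close>

locale delayed_walk =
  fixes p q r :: real
  assumes pos: "0 < p" "0 < q" "0 < r" and sum_1: "p + q + r = 1" and less: "p < q"
begin

abbreviation "K \<equiv> Q_kernel p q r"

definition s :: real where "s = sqrt (p / q)"

lemma s_pos: "0 < s" and s_less_1: "s < 1"
  using pos less by (simp_all add: s_def)

lemma p_eq: "p = q * s\<^sup>2"
  using pos by (simp add: s_def)

section \<open>Forward and backward equations\<close>

lemma pmf_bind_K:
  "pmf (bind_pmf \<nu> K) y =
     q * pmf \<nu> (Suc y) + (if y = 0 then pmf \<nu> 0 else r * pmf \<nu> y) +
     (if 2 \<le> y then p * pmf \<nu> (y - 1) else 0)"
proof -
  have "pmf (bind_pmf \<nu> K) y = (\<integral>x. Q_matrix p q r x y \<partial>\<nu>)"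
    using pos sum_1 by (simp add: pmf_bind pmf_Q_kernel)
  also have "\<dots> = (\<Sum>x\<in>{y - 1, y, Suc y}. pmf \<nu> x * Q_matrix p q r x y)"
    by (subst integral_measure_pmf[where A = "{y - 1, y, Suc y}"])
       (auto simp: Q_matrix_def split: if_splits)
  also have "\<dots> = q * pmf \<nu> (Suc y) + (if y = 0 then pmf \<nu> 0 else r * pmf \<nu> y) +
     (if 2 \<le> y then p * pmf \<nu> (y - 1) else 0)"
    by (cases y) (auto simp: Q_matrix_def)
  finally show ?thesis .
qed

lemma evolve_0 [simp]: "evolve K 0 \<nu> = \<nu>"
  by (simp add: evolve_def)

lemma evolve_Suc: "evolve K (Suc n) \<nu> = bind_pmf (evolve K n \<nu>) K"
  by (simp add: evolve_def)

lemma evolve_Suc': "evolve K (Suc n) \<nu> = evolve K n (bind_pmf \<nu> K)"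
  unfolding evolve_def funpow_Suc_right by simp

lemma evolve_conv_bind: "evolve K n \<nu> = bind_pmf \<nu> (\<lambda>x. evolve K n (return_pmf x))"
proof (induction n)
  case 0
  then show ?case by (simp add: bind_return_pmf')
next
  case (Suc n)
  have "evolve K (Suc n) \<nu> = bind_pmf (bind_pmf \<nu> (\<lambda>x. evolve K n (return_pmf x))) K"
    using Suc by (simp add: evolve_Suc)
  then show ?case by (simp add: bind_assoc_pmf evolve_Suc)
qed

text \<open>Conditioning on the first step rather than the last links different initial states at a
  fixed target \<open>y\<close>.\<close>

lemma evolve_backward:
  "pmf (evolve K (Suc n) (return_pmf (Suc x))) y =
     q * pmf (evolve K n (return_pmf x)) y + r * pmf (evolve K n (return_pmf (Suc x))) y +
     p * pmf (evolve K n (return_pmf (Suc (Suc x)))) y"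
proof -
  have "evolve K (Suc n) (return_pmf (Suc x)) =
      bind_pmf (K (Suc x)) (\<lambda>z. evolve K n (return_pmf z))"
    by (simp add: evolve_Suc' bind_return_pmf evolve_conv_bind[symmetric])
  then have "pmf (evolve K (Suc n) (return_pmf (Suc x))) y =
      (\<integral>z. pmf (evolve K n (return_pmf z)) y \<partial>K (Suc x))"
    by (simp add: pmf_bind)
  also have "\<dots> = (\<Sum>z\<in>{x, Suc x, Suc (Suc x)}. pmf (K (Suc x)) z * pmf (evolve K n (return_pmf z)) y)"
    using pos sum_1
    by (subst integral_measure_pmf[where A = "{x, Suc x, Suc (Suc x)}"])
       (auto simp: set_pmf_eq pmf_Q_kernel Q_matrix_def split: if_splits)
  finally show ?thesis
    using pos sum_1 by (simp add: pmf_Q_kernel Q_matrix_def)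
qed

lemma evolve_absorbed: "evolve K n (return_pmf 0) = return_pmf 0"
proof (induction n)
  case (Suc n)
  have "pmf (K 0) y = pmf (return_pmf 0) y" for y
    using pos sum_1 by (simp add: pmf_Q_kernel Q_matrix_def)
  then have "K 0 = return_pmf 0" by (rule pmf_eqI)
  with Suc show ?case by (simp add: evolve_Suc bind_return_pmf)
qed simp

section \<open>Survival probabilities and conditioning\<close>

definition surv :: "nat \<Rightarrow> nat pmf \<Rightarrow> real" where
  "surv n \<nu> = 1 - pmf (evolve K n \<nu>) 0"

lemma surv_pos:
  assumes "prob_on_pos \<nu>"
  shows "0 < surv n \<nu>"
proof -
  obtain x where x: "x \<in> set_pmf (evolve K n \<nu>)" "x \<ge> 1"
    using evolve_not_absorbed[OF pos sum_1 assms, of n] by auto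
  then have "0 < pmf (evolve K n \<nu>) x" by (simp add: pmf_positive)
  moreover have "(\<Sum>z\<in>{0, x}. pmf (evolve K n \<nu>) z) \<le> 1"
    by (metis finite.emptyI finite.insertI measure_measure_pmf_finite measure_pmf.prob_le_1)
  ultimately show ?thesis using x(2) by (simp add: surv_def)
qed

text \<open>New absorption happens only by a jump from state \<open>1\<close>, of probability
  \<open>q\<close>.\<close>

lemma surv_Suc: "surv (Suc n) \<nu> = surv n \<nu> - q * pmf (evolve K n \<nu>) 1"
  by (simp add: surv_def evolve_Suc pmf_bind_K)

lemma pmf_cond:
  assumes "prob_on_pos \<nu>"
  shows "pmf (cond_evolve K n \<nu>) y = (if y = 0 then 0 else pmf (evolve K n \<nu>) y / surv n \<nu>)"
  using pmf_cond_evolve[OF pos sum_1 assms] by (simp add: surv_def)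

lemma prob_on_pos_cond:
  assumes "prob_on_pos \<nu>"
  shows "prob_on_pos (cond_evolve K n \<nu>)"
  using pmf_cond[OF assms] by (simp add: prob_on_pos_def)

lemma prob_on_pos_return [simp]: "1 \<le> x \<Longrightarrow> prob_on_pos (return_pmf x)"
  by (simp add: prob_on_pos_def)

section \<open>Comparison of conditioned laws\<close>

lemma cond_stoch_le:
  assumes "prob_on_pos \<mu>" "prob_on_pos \<nu>" "lr_le (pmf (evolve K m \<mu>)) (pmf (evolve K n \<nu>))"
  shows "cond_evolve K m \<mu> \<preceq>\<^sub>s\<^sub>t cond_evolve K n \<nu>"
proof (rule lr_le_imp_stoch_le)
  show "lr_le (pmf (cond_evolve K m \<mu>)) (pmf (cond_evolve K n \<nu>))"
    using surv_pos[OF assms(1), of m] surv_pos[OF assms(2), of n]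
    by (intro lr_le_scale[OF assms(3), of "1 / surv m \<mu>" "1 / surv n \<nu>"])
       (auto simp: pmf_cond assms)
qed (use assms in \<open>auto intro: prob_on_pos_cond\<close>)

text \<open>By Cauchy-Binet, each 2 by 2 minor of the images is a combination of the minors
  \<open>D i j\<close>, weighted by minors of the kernel.\<close>

lemma lr_le_bind_K:
  assumes pq: "p * q \<le> r\<^sup>2" and lr: "lr_le (pmf \<mu>) (pmf \<nu>)"
  shows "lr_le (pmf (bind_pmf \<mu> K)) (pmf (bind_pmf \<nu> K))"
  unfolding lr_le_def
proof (intro allI impI)
  \<comment> \<open>Absorbed mass never returns, so state \<open>0\<close> may be zeroed;
    \<open>bf\<close> and \<open>bg\<close> then also cover the target \<open>1\<close>.\<close>
  define f where "f y = (if y = 0 then 0 else pmf \<mu> y)" for y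
  define g where "g y = (if y = 0 then 0 else pmf \<nu> y)" for y
  define D where "D i j = f i * g j - f j * g i" for i j
  have D: "0 \<le> D i j" if "i \<le> j" for i j
    using lr_leD[OF lr, of i j] that by (cases "i = 0") (auto simp: D_def f_def g_def)
  have bf: "pmf (bind_pmf \<mu> K) (Suc y) = q * f (Suc (Suc y)) + r * f (Suc y) + p * f y" for y
    by (simp add: pmf_bind_K f_def)
  have bg: "pmf (bind_pmf \<nu> K) (Suc y) = q * g (Suc (Suc y)) + r * g (Suc y) + p * g y" for y
    by (simp add: pmf_bind_K g_def)
  fix x y :: nat
  assume "1 \<le> x" "x \<le> y"
  then obtain a b where ab: "x = Suc a" "y = Suc b" "a \<le> b"
    by (metis Suc_le_D Suc_le_mono One_nat_def)
  let ?d = "pmf (bind_pmf \<mu> K) x * pmf (bind_pmf \<nu> K) y - pmf (bind_pmf \<mu> K) y * pmf (bind_pmf \<nu> K) x"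
  consider "b = a" | "b = Suc a" | "Suc (Suc a) \<le> b" using ab(3) by linarith
  then have "0 \<le> ?d"
  proof cases
    case 2
    \<comment> \<open>For adjacent targets, \<open>D (a + 1) (a + 2)\<close> arises with weight
      \<open>r * r\<close> and, reversed, with weight \<open>p * q\<close>; the hypothesis
      \<open>pq\<close> makes the net weight nonnegative.\<close>
    have "?d = p * p * D a (a + 1) + p * r * D a (a + 2) + p * q * D a (a + 3)
        + (r\<^sup>2 - p * q) * D (a + 1) (a + 2) + r * q * D (a + 1) (a + 3) + q * q * D (a + 2) (a + 3)"
      unfolding ab 2 bf bg D_def
      by (simp add: algebra_simps power2_eq_square numeral_3_eq_3)
    moreover have "0 \<le> (r\<^sup>2 - p * q) * D (a + 1) (a + 2)"
      using pq D by (intro mult_nonneg_nonneg) auto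
    ultimately show ?thesis using pos D by (simp add: add_nonneg_nonneg)
  next
    case 3
    \<comment> \<open>Here \<open>a + 2 \<le> b\<close>, so all nine index pairs are in order and
      every term is nonnegative.\<close>
    have "?d = p * p * D a b + p * r * D a (b + 1) + p * q * D a (b + 2)
        + r * p * D (a + 1) b + r * r * D (a + 1) (b + 1) + r * q * D (a + 1) (b + 2)
        + q * p * D (a + 2) b + q * r * D (a + 2) (b + 1) + q * q * D (a + 2) (b + 2)"
      unfolding ab bf bg D_def by (simp add: algebra_simps)
    then show ?thesis using pos D 3 by (simp add: add_nonneg_nonneg)
  qed (simp add: ab)
  then show "pmf (bind_pmf \<mu> K) y * pmf (bind_pmf \<nu> K) x \<le> pmf (bind_pmf \<mu> K) x * pmf (bind_pmf \<nu> K) y"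
    by simp
qed

text \<open>The point mass at \<open>1\<close> charges only the least positive state, so it lies
  below every law at time \<open>0\<close>; the kernel preserves this.\<close>

lemma lr_le_evolve:
  assumes "p * q \<le> r\<^sup>2"
  shows "lr_le (pmf (evolve K n (return_pmf 1))) (pmf (evolve K n \<nu>))"
proof (induction n)
  case 0
  show ?case by (auto simp: lr_le_def indicator_def)
next
  case (Suc n)
  then show ?case by (simp add: evolve_Suc lr_le_bind_K[OF assms])
qed

text \<open>This is the left eigenvector equation on the positive states, with the one-step survival
  probability as eigenvalue.\<close>

lemma quasi_stationary_iff:
  assumes "prob_on_pos \<nu>"
  shows "quasi_stationary K \<nu> \<longleftrightarrow>
    (\<forall>y\<ge>1. pmf (evolve K 1 \<nu>) y = (1 - q * pmf \<nu> 1) * pmf \<nu> y)"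
proof -
  have s1: "surv 1 \<nu> = 1 - q * pmf \<nu> 1"
    using surv_Suc[of 0 \<nu>] assms by (simp add: surv_def prob_on_pos_def)
  have "quasi_stationary K \<nu> \<longleftrightarrow> (\<forall>y. pmf \<nu> y = pmf (cond_evolve K 1 \<nu>) y)"
    using assms by (simp add: quasi_stationary_def pmf_eq_iff)
  also have "\<dots> \<longleftrightarrow> (\<forall>y\<ge>1. pmf (evolve K 1 \<nu>) y = surv 1 \<nu> * pmf \<nu> y)"
  proof (rule iff_allI)
    fix y
    show "pmf \<nu> y = pmf (cond_evolve K 1 \<nu>) y \<longleftrightarrow>
        (1 \<le> y \<longrightarrow> pmf (evolve K 1 \<nu>) y = surv 1 \<nu> * pmf \<nu> y)"
      using assms surv_pos[OF assms, of 1]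
      by (cases "y = 0") (auto simp: pmf_cond prob_on_pos_def field_simps simp del: One_nat_def)
  qed
  finally show ?thesis unfolding s1 .
qed

lemma quasi_stationary_evolve:
  assumes "quasi_stationary K \<nu>" "1 \<le> y"
  shows "pmf (evolve K n \<nu>) y = (1 - q * pmf \<nu> 1) ^ n * pmf \<nu> y"
  using assms(2)
proof (induction n arbitrary: y)
  case (Suc n)
  have pos\<nu>: "prob_on_pos \<nu>" using assms(1) by (simp add: quasi_stationary_def)
  define c where "c = 1 - q * pmf \<nu> 1"
  have "pmf (evolve K (Suc n) \<nu>) y = c ^ n * pmf (bind_pmf \<nu> K) y"
    using Suc by (simp add: evolve_Suc pmf_bind_K c_def algebra_simps)
  also have "pmf (bind_pmf \<nu> K) y = c * pmf \<nu> y"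
    using quasi_stationary_iff[OF pos\<nu>] assms(1) Suc.prems evolve_Suc[of 0 \<nu>] by (simp add: c_def)
  finally show ?case by (simp add: c_def)
qed simp

text \<open>On the positive states \<open>evolve K 1 \<nu>\<close> is \<open>c / c ^ n\<close> times
  \<open>evolve K n \<nu>\<close>, so the comparison at time \<open>n\<close> also holds against
  time \<open>1\<close>, where conditioning returns \<open>\<nu>\<close>.\<close>

lemma cond_le_quasi_stationary:
  assumes "p * q \<le> r\<^sup>2" "quasi_stationary K \<nu>"
  shows "cond_evolve K n (return_pmf 1) \<preceq>\<^sub>s\<^sub>t \<nu>"
proof -
  have pos\<nu>: "prob_on_pos \<nu>" using assms(2) by (simp add: quasi_stationary_def)
  define c where "c = 1 - q * pmf \<nu> 1"
  have c: "0 < c"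
    using surv_pos[OF pos\<nu>, of 1] surv_Suc[of 0 \<nu>] pos\<nu> by (simp add: c_def surv_def prob_on_pos_def)
  have "lr_le (pmf (evolve K n (return_pmf 1))) (pmf (evolve K 1 \<nu>))"
    using c quasi_stationary_evolve[OF assms(2), folded c_def]
    by (intro lr_le_scale[OF lr_le_evolve[OF assms(1)], of 1 "c / c ^ n" _ n _ \<nu>]) auto
  then have "cond_evolve K n (return_pmf 1) \<preceq>\<^sub>s\<^sub>t cond_evolve K 1 \<nu>"
    using pos\<nu> by (intro cond_stoch_le) auto
  then show ?thesis using assms(2) by (simp add: quasi_stationary_def)
qed

section \<open>The minimal quasi-stationary distribution\<close>

lemma pmf_nu_min': "pmf (nu_min p q) y = (1 - s)\<^sup>2 * (real y * s ^ (y - 1))"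
  using pos less by (simp add: pmf_nu_min s_def)

lemma prob_on_pos_nu_min: "prob_on_pos (nu_min p q)"
  by (simp add: prob_on_pos_def pmf_nu_min')

text \<open>As \<open>q * s\<close> equals \<open>sqrt (p * q)\<close>, this is the critical
  eigenvalue.\<close>

lemma eigenvalue_nu_min: "1 - q * pmf (nu_min p q) 1 = r + 2 * q * s"
proof -
  have "r = 1 - q - q * s\<^sup>2" using sum_1 p_eq by simp
  then show ?thesis by (simp add: pmf_nu_min' power2_eq_square algebra_simps)
qed

text \<open>The characteristic polynomial is \<open>q * (z - s)\<^sup>2\<close>; its double root
  \<open>s\<close> accounts for the factor \<open>y\<close> in the solution.\<close>

lemma nu_min_rec:
  "q * pmf (nu_min p q) (Suc (Suc y)) =
     2 * q * s * pmf (nu_min p q) (Suc y) - p * pmf (nu_min p q) y"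
proof (cases y)
  case (Suc z)
  show ?thesis unfolding pmf_nu_min' Suc by (subst p_eq) (simp add: power2_eq_square algebra_simps)
qed (simp add: pmf_nu_min')

lemma quasi_stationary_nu_min: "quasi_stationary K (nu_min p q)"
  unfolding quasi_stationary_iff[OF prob_on_pos_nu_min]
proof (intro allI impI)
  fix y :: nat
  assume "1 \<le> y"
  then obtain z where y: "y = Suc z" by (cases y) auto
  have "pmf (nu_min p q) 0 = 0" by (simp add: pmf_nu_min')
  then show "pmf (evolve K 1 (nu_min p q)) y = (1 - q * pmf (nu_min p q) 1) * pmf (nu_min p q) y"
    unfolding eigenvalue_nu_min y using nu_min_rec[of z]
    by (cases z) (simp_all add: evolve_Suc pmf_bind_K algebra_simps)
qed

text \<open>The bound on \<open>m 1\<close> makes the eigenvalue at most critical, nonnegativity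
  makes it at least critical. Equality determines \<open>m 1\<close>, hence the scale, and the
  recursion determines the rest.\<close>

lemma eq_nu_min:
  assumes "m 0 = 0" "\<And>y. 0 \<le> m y" "pmf (nu_min p q) 1 \<le> m 1"
    and rec: "\<And>y. q * m (Suc (Suc y)) = (1 - q * m 1 - r) * m (Suc y) - p * m y"
  shows "m y = pmf (nu_min p q) y"
proof -
  define c where "c = 1 - q * m 1 - r"
  have m1: "0 < m 1"
  proof (rule less_le_trans[OF _ assms(3)])
    show "0 < pmf (nu_min p q) 1" using s_less_1 by (simp add: pmf_nu_min')
  qed
  have c_le: "c \<le> 2 * q * s"
    using eigenvalue_nu_min pos mult_left_mono[OF assms(3), of q] unfolding c_def by linarith
  \<comment> \<open>Since \<open>p = q * s\<^sup>2\<close>, dividing by \<open>s ^ y\<close> brings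
    the recursion to the form of \<open>nonneg_recursion_ge_1\<close>.\<close>
  define w where "w y = m y / s ^ y" for y
  have "1 \<le> c / (2 * q * s)"
  proof (rule nonneg_recursion_ge_1[of w])
    show "w (Suc (Suc n)) = 2 * (c / (2 * q * s)) * w (Suc n) - w n" for n
    proof -
      have "m (Suc (Suc n)) = (c * m (Suc n) - q * s\<^sup>2 * m n) / q"
        using rec[of n] pos p_eq by (simp add: c_def field_simps)
      then show ?thesis
        using pos s_pos by (simp add: w_def field_simps power2_eq_square)
    qed
  qed (use assms m1 s_pos in \<open>auto simp: w_def\<close>)
  then have c: "c = 2 * q * s"
    using c_le pos s_pos by (simp add: field_simps)
  have "q * m 1 = q * pmf (nu_min p q) 1"
    using eigenvalue_nu_min c unfolding c_def by linarith
  then have m1_eq: "m 1 = pmf (nu_min p q) 1"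
    using pos by simp
  have "m y = pmf (nu_min p q) y \<and> m (Suc y) = pmf (nu_min p q) (Suc y)"
  proof (induction y)
    case 0
    show ?case using assms(1) m1_eq by (simp add: pmf_nu_min')
  next
    case (Suc y)
    then have "q * m (Suc (Suc y)) = q * pmf (nu_min p q) (Suc (Suc y))"
      using rec[of y] nu_min_rec[of y] c by (simp add: c_def)
    with Suc pos show ?case by simp
  qed
  then show ?thesis ..
qed

text \<open>Time \<open>n + 1\<close> from \<open>1\<close> is time \<open>n\<close> from the law
  after one step, which dominates the point mass at \<open>1\<close>.\<close>

lemma cond_mono:
  assumes "p * q \<le> r\<^sup>2"
  shows "cond_evolve K n (return_pmf 1) \<preceq>\<^sub>s\<^sub>t cond_evolve K (n + 1) (return_pmf 1)"
  using lr_le_evolve[OF assms, of n "bind_pmf (return_pmf 1) K"]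
  by (intro cond_stoch_le) (auto simp: evolve_Suc')

lemma cond_tendsto_nu_min:
  assumes pq: "p * q \<le> r\<^sup>2"
  shows "(\<lambda>n. pmf (cond_evolve K n (return_pmf 1)) y) \<longlonglongrightarrow> pmf (nu_min p q) y"
proof -
  define M where "M n = cond_evolve K n (return_pmf 1)" for n
  define G where "G n x = measure_pmf.prob (M n) {x..}" for n x
  \<comment> \<open>Tails are monotone in \<open>n\<close> and bounded by \<open>1\<close>, so they
    converge; point masses converge as differences of tails.\<close>
  have "incseq (\<lambda>n. G n x)" for x
    using cond_mono[OF pq] unfolding stoch_le_iff_tails by (auto simp: incseq_Suc_iff G_def M_def)
  then have "convergent (\<lambda>n. G n x)" for x
    by (intro Bseq_mono_convergent)
       (auto intro!: BseqI'[where K = 1] simp: G_def incseq_def)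
  then obtain L where L: "(\<lambda>n. G n x) \<longlonglongrightarrow> L x" for x
    unfolding convergent_def by metis
  define m where "m y = L y - L (Suc y)" for y
  have pmf_M: "pmf (M n) y = G n y - G n (Suc y)" for n y
    by (simp add: G_def prob_atLeast_eq)
  have lim: "(\<lambda>n. pmf (M n) y) \<longlonglongrightarrow> m y" for y
    unfolding pmf_M m_def by (intro tendsto_intros L)
  have M0: "pmf (M n) 0 = 0" for n
    by (simp add: M_def pmf_cond)
  define S where "S n = surv n (return_pmf 1)" for n
  have S: "0 < S n" for n by (simp add: S_def surv_pos)
  have ratio: "S (Suc n) = (1 - q * pmf (M n) 1) * S n" for n
    using S[of n] by (simp add: S_def surv_Suc M_def pmf_cond field_simps)
  \<comment> \<open>The forward equation divided by the survival probability; its limit is the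
    eigenvalue recursion for \<open>m\<close>.\<close>
  have step: "(1 - q * pmf (M n) 1) * pmf (M (Suc n)) (Suc y) =
      q * pmf (M n) (Suc (Suc y)) + r * pmf (M n) (Suc y) + p * pmf (M n) y" for n y
  proof -
    have "pmf (M (Suc n)) (Suc y) * S (Suc n) = pmf (bind_pmf (evolve K n (return_pmf 1)) K) (Suc y)"
      using S[of "Suc n"] by (simp add: M_def pmf_cond S_def evolve_Suc)
    also have "\<dots> = (q * pmf (M n) (Suc (Suc y)) + r * pmf (M n) (Suc y) + p * pmf (M n) y) * S n"
      using S[of n] by (simp add: pmf_bind_K M_def pmf_cond S_def field_simps)
    finally show ?thesis using S[of n] by (simp add: ratio mult.commute)
  qed
  have "m y = pmf (nu_min p q) y"
  proof (rule eq_nu_min)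
    show "m 0 = 0"
      using lim[of 0] by (simp add: M0 LIMSEQ_const_iff)
    show "0 \<le> m y" for y
      using lim[of y] by (rule LIMSEQ_le_const) auto
    show "pmf (nu_min p q) 1 \<le> m 1"
    proof (rule LIMSEQ_le_const[OF lim], intro exI allI impI)
      fix n :: nat
      \<comment> \<open>Neither law charges \<open>0\<close>, so the tail from \<open>2\<close> is
        one minus the mass at \<open>1\<close>, and the inequality reverses for that mass.\<close>
      have "measure_pmf.prob (M n) {2..} \<le> measure_pmf.prob (nu_min p q) {2..}"
        using cond_le_quasi_stationary[OF pq quasi_stationary_nu_min]
        unfolding stoch_le_iff_tails M_def by blast
      then show "pmf (nu_min p q) 1 \<le> pmf (M n) 1"
        using M0 prob_on_pos_nu_min by (simp add: prob_atLeast_eq prob_on_pos_def numeral_2_eq_2)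
    qed
    show "q * m (Suc (Suc y)) = (1 - q * m 1 - r) * m (Suc y) - p * m y" for y
    proof -
      have "(\<lambda>n. (1 - q * pmf (M n) 1) * pmf (M (Suc n)) (Suc y)) \<longlonglongrightarrow> (1 - q * m 1) * m (Suc y)"
        by (intro tendsto_intros lim LIMSEQ_Suc[OF lim])
      moreover have "(\<lambda>n. (1 - q * pmf (M n) 1) * pmf (M (Suc n)) (Suc y))
          \<longlonglongrightarrow> q * m (Suc (Suc y)) + r * m (Suc y) + p * m y"
        unfolding step by (intro tendsto_intros lim)
      ultimately have "(1 - q * m 1) * m (Suc y) = q * m (Suc (Suc y)) + r * m (Suc y) + p * m y"
        by (rule LIMSEQ_unique)
      then show ?thesis by (simp add: algebra_simps)
    qed
  qed
  with lim[of y] show ?thesis by (simp add: M_def)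
qed

text \<open>A tail is one minus a finite sum of point masses, so pointwise convergence carries the
  tail bounds to the limit.\<close>

lemma nu_min_le_quasi_stationary:
  assumes "p * q \<le> r\<^sup>2" "quasi_stationary K \<nu>"
  shows "nu_min p q \<preceq>\<^sub>s\<^sub>t \<nu>"
  unfolding stoch_le_iff_tails
proof
  fix x
  have "(\<lambda>n. measure_pmf.prob (cond_evolve K n (return_pmf 1)) {x..}) \<longlonglongrightarrow>
      measure_pmf.prob (nu_min p q) {x..}"
    unfolding prob_atLeast_eq by (intro tendsto_intros cond_tendsto_nu_min assms(1))
  then show "measure_pmf.prob (nu_min p q) {x..} \<le> measure_pmf.prob \<nu> {x..}"
    using cond_le_quasi_stationary[OF assms]
    by (intro LIMSEQ_le_const2) (auto simp: stoch_le_iff_tails)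
qed

section \<open>Yaglom limits of point masses\<close>

text \<open>The limit \<open>x s\<^sup>1\<^sup>-\<^sup>x\<close> is the right eigenfunction for the critical eigenvalue.\<close>

lemma backward_ratio_tendsto:
  fixes F :: "nat \<Rightarrow> nat \<Rightarrow> real" and S :: "nat \<Rightarrow> real"
  assumes "\<And>n. 0 < S n" "(\<lambda>n. S (Suc n) / S n) \<longlonglongrightarrow> r + 2 * q * s"
    and "\<And>n. F 0 n = 0" "(\<lambda>n. F 1 n / S n) \<longlonglongrightarrow> L"
    and rec: "\<And>x n. F (Suc x) (Suc n) = q * F x n + r * F (Suc x) n + p * F (Suc (Suc x)) n"
  shows "(\<lambda>n. F x n / S n) \<longlonglongrightarrow> real x * s / s ^ x * L"
proof -
  have "((\<lambda>n. F x n / S n) \<longlonglongrightarrow> real x * s / s ^ x * L) \<and>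
      ((\<lambda>n. F (Suc x) n / S n) \<longlonglongrightarrow> real (Suc x) * s / s ^ Suc x * L)"
  proof (induction x)
    case 0
    show ?case using assms(3,4) s_pos by simp
  next
    case (Suc x)
    let ?h = "\<lambda>x. real x * s / s ^ x * L"
    \<comment> \<open>The backward equation solved for the farthest state; the time shift costs a
      factor \<open>S (Suc n) / S n\<close>, whose limit is known.\<close>
    have eq: "F (Suc (Suc x)) n / S n =
        (F (Suc x) (Suc n) / S (Suc n) * (S (Suc n) / S n) - q * (F x n / S n)
          - r * (F (Suc x) n / S n)) / p" for n
      using assms(1)[of n] assms(1)[of "Suc n"] pos by (simp add: rec field_simps)
    have "(\<lambda>n. F (Suc (Suc x)) n / S n) \<longlonglongrightarrow>
        (?h (Suc x) * (r + 2 * q * s) - q * ?h x - r * ?h (Suc x)) / p"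
      unfolding eq using Suc pos assms(2)
      by (intro tendsto_intros LIMSEQ_Suc[where f = "\<lambda>n. F (Suc x) n / S n"]) auto
    also have "(?h (Suc x) * (r + 2 * q * s) - q * ?h x - r * ?h (Suc x)) / p = ?h (Suc (Suc x))"
      using s_pos pos by (subst p_eq) (simp add: field_simps power2_eq_square)
    finally show ?case using Suc by simp
  qed
  then show ?thesis ..
qed

text \<open>Point probabilities and survival probabilities from \<open>x\<close> obey the same
  backward equation. Relative to \<open>S\<close> both acquire the factor \<open>?h\<close>, which
  cancels in the quotient.\<close>

lemma yaglom_limit_return:
  assumes pq: "p * q \<le> r\<^sup>2" and x: "1 \<le> x"
  shows "yaglom_limit K (return_pmf x) (nu_min p q)"
  unfolding yaglom_limit_def pmf_tendsto_def
proof (intro conjI allI)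
  show "prob_on_pos (nu_min p q)" by (rule prob_on_pos_nu_min)
  fix y
  define S where "S n = surv n (return_pmf 1)" for n
  have S: "0 < S n" for n by (simp add: S_def surv_pos)
  show "(\<lambda>n. pmf (cond_evolve K n (return_pmf x)) y) \<longlonglongrightarrow> pmf (nu_min p q) y"
  proof (cases "y = 0")
    case True
    then show ?thesis using x prob_on_pos_nu_min by (simp add: pmf_cond prob_on_pos_def)
  next
    case y: False
    have "S (Suc n) / S n = 1 - q * pmf (cond_evolve K n (return_pmf 1)) 1" for n
      using S[of n] by (simp add: S_def surv_Suc pmf_cond field_simps)
    then have ratio: "(\<lambda>n. S (Suc n) / S n) \<longlonglongrightarrow> r + 2 * q * s"
      unfolding eigenvalue_nu_min[symmetric]
      by (simp only:) (intro tendsto_intros cond_tendsto_nu_min pq)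
    let ?h = "real x * s / s ^ x"
    have P: "(\<lambda>n. pmf (evolve K n (return_pmf x)) y / S n) \<longlonglongrightarrow> ?h * pmf (nu_min p q) y"
    proof (rule backward_ratio_tendsto[OF S ratio])
      show "(\<lambda>n. pmf (evolve K n (return_pmf 1)) y / S n) \<longlonglongrightarrow> pmf (nu_min p q) y"
        using cond_tendsto_nu_min[OF pq, of y] y by (simp add: pmf_cond S_def)
    qed (use y in \<open>simp_all add: evolve_absorbed evolve_backward\<close>)
    have "(\<lambda>n. surv n (return_pmf x) / S n) \<longlonglongrightarrow> ?h * 1"
    proof (rule backward_ratio_tendsto[OF S ratio])
      show "(\<lambda>n. surv n (return_pmf 1) / S n) \<longlonglongrightarrow> 1"
        using S by (simp add: S_def less_imp_neq[symmetric])
      \<comment> \<open>Taking complements in the backward equation at target \<open>0\<close> is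
        possible because \<open>p + q + r = 1\<close>.\<close>
      show "surv (Suc n) (return_pmf (Suc x)) = q * surv n (return_pmf x) +
          r * surv n (return_pmf (Suc x)) + p * surv n (return_pmf (Suc (Suc x)))" for x n
        using sum_1 by (simp add: surv_def evolve_backward algebra_simps)
    qed (simp add: surv_def evolve_absorbed)
    with P have "(\<lambda>n. (pmf (evolve K n (return_pmf x)) y / S n) / (surv n (return_pmf x) / S n))
        \<longlonglongrightarrow> ?h * pmf (nu_min p q) y / (?h * 1)"
      using x s_pos by (intro tendsto_intros) auto
    moreover have "(pmf (evolve K n (return_pmf x)) y / S n) / (surv n (return_pmf x) / S n) =
        pmf (cond_evolve K n (return_pmf x)) y" for n
      using S[of n] x y by (simp add: pmf_cond)
    ultimately show ?thesis using x s_pos by simp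
  qed
qed

end

theorem corollary7:
  fixes p q r :: real and Q :: "nat \<Rightarrow> nat pmf"
  assumes "0 < p" and "0 < q" and "0 < r" and "p + q + r = 1" and "p < q"
    and "Q = Q_kernel p q r"
    and "p * q \<le> r\<^sup>2"
  shows "(\<forall>n. cond_evolve Q n (return_pmf 1) \<preceq>\<^sub>s\<^sub>t cond_evolve Q (n + 1) (return_pmf 1)) \<and>
    (\<forall>\<nu> n. prob_on_pos \<nu> \<longrightarrow> cond_evolve Q n (return_pmf 1) \<preceq>\<^sub>s\<^sub>t cond_evolve Q n \<nu>) \<and>
    (\<forall>\<nu>. quasi_stationary Q \<nu> \<longrightarrow> (\<forall>n. cond_evolve Q n (return_pmf 1) \<preceq>\<^sub>s\<^sub>t \<nu>)) \<and>
    (pmf_tendsto (\<lambda>n. cond_evolve Q n (return_pmf 1)) (nu_min p q) \<and>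
     quasi_stationary Q (nu_min p q) \<and>
     (\<forall>\<nu>. quasi_stationary Q \<nu> \<and> \<nu> \<noteq> nu_min p q \<longrightarrow> nu_min p q \<preceq>\<^sub>s\<^sub>t \<nu>)) \<and>
    (\<forall>x\<ge>1. yaglom_limit Q (return_pmf x) (nu_min p q))"
proof -
  interpret delayed_walk p q r
    using assms by unfold_locales
  note pq = \<open>p * q \<le> r\<^sup>2\<close>
  have le: "cond_evolve K n (return_pmf 1) \<preceq>\<^sub>s\<^sub>t cond_evolve K n \<nu>" if "prob_on_pos \<nu>" for \<nu> n
    using that lr_le_evolve[OF pq] by (intro cond_stoch_le) auto
  show ?thesis
    unfolding \<open>Q = K\<close> pmf_tendsto_def
    using cond_mono[OF pq] le cond_le_quasi_stationary[OF pq] cond_tendsto_nu_min[OF pq]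
      quasi_stationary_nu_min nu_min_le_quasi_stationary[OF pq] yaglom_limit_return[OF pq]
    by blast
qed

end
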